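(* Let $\Omega\subset\mathbb{C}^n$ be a product $\Omega=\Omega_1\times\cdots\times\Omega_n$, where $\Omega_i$ is a bounded domain in $\mathbb{C}$ for each $i=1,\dots,n$. Then for every $z=(z_1,\dots,z_n)\in\Omega$, \[ S_\Omega(z)\geq\left(S_{\Omega_1}(z_1)^{-2}+\cdots+S_{\Omega_n}(z_n)^{-2}\right)^{-1/2}, \] where $S_\Omega$ and $S_{\Omega_i}$ denote the squeezing functions of $\Omega$ and $\Omega_i$ respectively.
   Context: For a bounded domain $\Omega\subset\mathbb{C}^m$ ($m\ge1$) and $z\in\Omega$, let $\mathcal{F}_\Omega(z)$ be the collection of all holomorphic embeddings (injective holomorphic maps) $f:\Omega\to\mathbb{C}^m$ with $f(z)=0$. Let $B(0;\rho)=\{w\in\mathbb{C}^m:\|w\|<\rho\}$ be the open Euclidean ball of radius $\rho>0$ centered at $0$. The squeezing function of $\Omega$ at $z$ is \[ S_\Omega(z)=\sup_{f\in\mathcal{F}_\Omega(z)}\left\{\frac{a}{b} : B(0;a)\subset f(\Omega)\subset B(0;b)\right\}, \] where the supremum is over all $f\in\mathcal{F}_\Omega(z)$ and all $a,b>0$ satisfying the displayed inclusions. For the planar domains $\Omega_i$ this is used with $m=1$, and for $\Omega$ with $m=n$. *)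

theory Defs
  imports "HOL-Analysis.Analysis"
begin

definition bounded_domain :: "'a::metric_space set \<Rightarrow> bool" where
  "bounded_domain S \<longleftrightarrow> open S \<and> connected S \<and> S \<noteq> {} \<and> bounded S"

text \<open>Complex Frechet differentiability. The library's \<open>has_derivative\<close> only supplies a
  real-linear derivative, so complex homogeneity is required explicitly.\<close>

definition holomorphic_map_on :: "(complex^'m \<Rightarrow> complex^'k) \<Rightarrow> (complex^'m) set \<Rightarrow> bool" where
  "holomorphic_map_on f S \<longleftrightarrow>
     (\<forall>z\<in>S. \<exists>f'. (f has_derivative f') (at z within S) \<and> (\<forall>c v. f' (c *s v) = c *s f' v))"

text \<open>Maps defined on \<open>S\<close> are represented by total functions whose values outside \<open>S\<close>
  are irrelevant.\<close>

definition pointed_embeddings ::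
    "(complex^'m) set \<Rightarrow> complex^'m \<Rightarrow> (complex^'m \<Rightarrow> complex^'m) set" where
  "pointed_embeddings S z = {f. holomorphic_map_on f S \<and> inj_on f S \<and> f z = 0}"

text \<open>The norm of \<open>complex^'m\<close> is the Euclidean one, so \<open>ball\<close> is the Euclidean ball.
  For a bounded domain containing \<open>z\<close> the set below is nonempty and bounded above, so the
  real-valued \<open>Sup\<close> is the actual supremum.\<close>

definition squeezing_function :: "(complex^'m) set \<Rightarrow> complex^'m \<Rightarrow> real" where
  "squeezing_function S z =
     Sup {a / b | a b. 0 < a \<and> 0 < b \<and>
            (\<exists>f \<in> pointed_embeddings S z. ball 0 a \<subseteq> f ` S \<and> f ` S \<subseteq> ball 0 b)}"

text \<open>The case \<open>m = 1\<close>, with \<open>complex\<close> identified with \<open>complex^1\<close> via \<open>vec\<close>.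
  The lemma \<open>planar_squeezing_function_eq\<close> below gives the intrinsic description.\<close>

definition planar_squeezing_function :: "complex set \<Rightarrow> complex \<Rightarrow> real" where
  "planar_squeezing_function D z = squeezing_function (vec ` D :: (complex^1) set) (vec z)"

lemma squeezing_set_bdd_above:
  fixes S :: "(complex^'m) set"
  shows "bdd_above {a / b | a b. 0 < a \<and> 0 < b \<and>
            (\<exists>f \<in> pointed_embeddings S z. ball 0 a \<subseteq> f ` S \<and> f ` S \<subseteq> ball 0 b)}"
proof (rule bdd_aboveI[of _ 1])
  fix x assume "x \<in> {a / b | a b. 0 < a \<and> 0 < b \<and>
            (\<exists>f \<in> pointed_embeddings S z. ball 0 a \<subseteq> f ` S \<and> f ` S \<subseteq> ball 0 b)}"
  then obtain a b where x: "x = a / b" and ab: "0 < a" "0 < b"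
    and "ball (0::complex^'m) a \<subseteq> ball 0 b" by blast
  then have "a \<le> b" by (simp add: ball_subset_ball_iff)
  then show "x \<le> 1" using x ab by simp
qed

lemma squeezing_set_nonempty:
  fixes S :: "(complex^'m) set"
  assumes "bounded_domain S" "z \<in> S"
  shows "{a / b | a b. 0 < a \<and> 0 < b \<and>
            (\<exists>f \<in> pointed_embeddings S z. ball 0 a \<subseteq> f ` S \<and> f ` S \<subseteq> ball 0 b)} \<noteq> {}"
proof -
  let ?f = "\<lambda>w. w - z"
  obtain a where a: "a > 0" "ball z a \<subseteq> S"
    using assms by (auto simp: bounded_domain_def open_contains_ball)
  have "bounded S" using assms by (simp add: bounded_domain_def)
  then obtain b where b: "b > 0" "S \<subseteq> ball z b"
    using bounded_subset_ballD[of S z] by blast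
  have "?f \<in> pointed_embeddings S z"
    unfolding pointed_embeddings_def holomorphic_map_on_def
    by (auto simp: inj_on_def intro!: exI[of _ "\<lambda>v. v"] derivative_eq_intros)
  moreover have "ball 0 a \<subseteq> ?f ` S"
  proof
    fix w :: "complex^'m" assume "w \<in> ball 0 a"
    then have "w + z \<in> S" using a by (auto simp: dist_norm subset_iff)
    then show "w \<in> ?f ` S" by (rule rev_image_eqI) simp
  qed
  moreover have "?f ` S \<subseteq> ball 0 b"
    using b by (auto simp: dist_norm norm_minus_commute)
  ultimately show ?thesis using a b by blast
qed

lemma norm_vec_1: "norm (vec x :: complex^1) = norm x"
  by (simp add: norm_vec_def)

lemma vec_nth_1 [simp]: "vec (v $ 1) = (v :: complex^1)"
  by (simp add: vec_eq_iff forall_1)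

lemma image_vec_ball: "vec ` ball 0 r = (ball 0 r :: (complex^1) set)"
proof -
  have "v \<in> vec ` ball 0 r" if "v \<in> ball 0 r" for v :: "complex^1"
    using that by (intro rev_image_eqI[of "v $ 1"]) (simp_all flip: norm_vec_1)
  then show ?thesis by (auto simp: norm_vec_1)
qed

lemma inj_vec_1: "inj (vec :: complex \<Rightarrow> complex^1)"
  by (auto simp: inj_def vec_eq_iff)

lemma bounded_linear_vec_1: "bounded_linear (vec :: complex \<Rightarrow> complex^1)"
  by (rule bounded_linear_intro[of _ 1]) (auto simp: vec_eq_iff norm_vec_1)

lemma holomorphic_map_on_vec_iff:
  fixes F :: "complex^1 \<Rightarrow> complex^1"
  shows "holomorphic_map_on F (vec ` D) \<longleftrightarrow> (\<lambda>w. F (vec w) $ 1) holomorphic_on D"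
proof
  assume L: "holomorphic_map_on F (vec ` D)"
  show "(\<lambda>w. F (vec w) $ 1) holomorphic_on D"
    unfolding holomorphic_on_def field_differentiable_def
  proof
    fix x assume "x \<in> D"
    then obtain F' where F': "(F has_derivative F') (at (vec x) within vec ` D)"
      and lin: "\<And>c v. F' (c *s v) = c *s F' v"
      using L by (auto simp: holomorphic_map_on_def)
    have "((\<lambda>w. F (vec w)) has_derivative (\<lambda>h. F' (vec h))) (at x within D)"
      using has_derivative_in_compose[OF bounded_linear.has_derivative[OF bounded_linear_vec_1
            has_derivative_ident] F'] .
    then have "((\<lambda>w. F (vec w) $ 1) has_derivative (\<lambda>h. F' (vec h) $ 1)) (at x within D)"
      by (rule bounded_linear.has_derivative[OF bounded_linear_vec_nth])
    moreover have "F' (vec h) $ 1 = F' (vec 1) $ 1 * h" for h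
    proof -
      have "vec h = h *s (vec 1 :: complex^1)" by (simp add: vec_eq_iff)
      then show ?thesis by (simp add: lin)
    qed
    ultimately show "\<exists>f'. ((\<lambda>w. F (vec w) $ 1) has_field_derivative f') (at x within D)"
      by (auto simp: has_field_derivative_def)
  qed
next
  assume R: "(\<lambda>w. F (vec w) $ 1) holomorphic_on D"
  show "holomorphic_map_on F (vec ` D)"
    unfolding holomorphic_map_on_def
  proof (intro ballI)
    fix z :: "complex^1" assume "z \<in> vec ` D"
    then obtain x where x: "x \<in> D" "z = vec x" by blast
    obtain d where d: "((\<lambda>w. F (vec w) $ 1) has_derivative (*) d) (at x within D)"
      using R x by (auto simp: holomorphic_on_def field_differentiable_def has_field_derivative_def)
    have proj: "(\<lambda>v::complex^1. v $ 1) ` vec ` D = D" by (simp add: image_image)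
    have "((\<lambda>v::complex^1. F (vec (v $ 1)) $ 1) has_derivative (\<lambda>v. d * v $ 1))
            (at z within vec ` D)"
      using has_derivative_in_compose[OF bounded_linear.has_derivative[OF bounded_linear_vec_nth
            has_derivative_ident], of "\<lambda>w. F (vec w) $ 1" "(*) d" z 1 "vec ` D"] d x proj
      by simp
    from bounded_linear.has_derivative[OF bounded_linear_vec_1 this]
    have "(F has_derivative (\<lambda>v. vec (d * v $ 1))) (at z within vec ` D)" by simp
    then show "\<exists>F'. (F has_derivative F') (at z within vec ` D) \<and> (\<forall>c v. F' (c *s v) = c *s F' v)"
      by (intro exI[of _ "\<lambda>v. vec (d * v $ 1)"]) (auto simp: vec_eq_iff)
  qed
qed

lemma planar_squeezing_function_eq:
  "planar_squeezing_function D z =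
     Sup {a / b | a b. 0 < a \<and> 0 < b \<and>
            (\<exists>f. f holomorphic_on D \<and> inj_on f D \<and> f z = 0 \<and>
                 ball 0 a \<subseteq> f ` D \<and> f ` D \<subseteq> ball 0 b)}"
proof -
  have key: "(\<exists>F \<in> pointed_embeddings (vec ` D :: (complex^1) set) (vec z).
               ball 0 a \<subseteq> F ` vec ` D \<and> F ` vec ` D \<subseteq> ball 0 b) \<longleftrightarrow>
             (\<exists>f. f holomorphic_on D \<and> inj_on f D \<and> f z = 0 \<and>
                 ball 0 a \<subseteq> f ` D \<and> f ` D \<subseteq> ball 0 b)" (is "?L \<longleftrightarrow> ?R") for a b
  proof
    assume ?L
    then obtain F :: "complex^1 \<Rightarrow> complex^1" where
      F: "holomorphic_map_on F (vec ` D)" "inj_on F (vec ` D)" "F (vec z) = 0"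
      and B: "ball 0 a \<subseteq> F ` vec ` D" "F ` vec ` D \<subseteq> ball 0 b"
      by (auto simp: pointed_embeddings_def)
    define f where "f = (\<lambda>w. F (vec w) $ 1)"
    have im: "F ` vec ` D = vec ` f ` D" by (simp add: f_def image_image)
    have "inj_on f D"
    proof (rule inj_onI)
      fix x y assume xy: "x \<in> D" "y \<in> D" "f x = f y"
      then have "F (vec x) = F (vec y)" unfolding f_def by (metis vec_nth_1)
      then have "(vec x :: complex^1) = vec y" using F(2) xy by (meson imageI inj_onD)
      then show "x = y" by (rule injD[OF inj_vec_1])
    qed
    moreover have "ball 0 a \<subseteq> f ` D" "f ` D \<subseteq> ball 0 b"
      using B unfolding im by (simp_all add: inj_image_subset_iff[OF inj_vec_1] flip: image_vec_ball)
    ultimately show ?R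
      using F by (intro exI[of _ f]) (simp add: f_def holomorphic_map_on_vec_iff)
  next
    assume ?R
    then obtain f where f: "f holomorphic_on D" "inj_on f D" "f z = 0"
      and B: "ball 0 a \<subseteq> f ` D" "f ` D \<subseteq> ball 0 b" by blast
    define F :: "complex^1 \<Rightarrow> complex^1" where "F = (\<lambda>v. vec (f (v $ 1)))"
    have im: "F ` vec ` D = vec ` f ` D" by (simp add: F_def image_image)
    have "F \<in> pointed_embeddings (vec ` D) (vec z)"
      using f by (auto simp: pointed_embeddings_def holomorphic_map_on_vec_iff F_def inj_on_def
          vec_eq_iff)
    moreover have "ball 0 a \<subseteq> F ` vec ` D" "F ` vec ` D \<subseteq> ball 0 b"
      using B unfolding im by (simp_all add: inj_image_subset_iff[OF inj_vec_1] flip: image_vec_ball)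
    ultimately show ?L by blast
  qed
  show ?thesis
    unfolding planar_squeezing_function_def squeezing_function_def key ..
qed

end

theory Submission imports Defs begin

text \<open>Fix for each factor an injective holomorphic map \<open>f i\<close> with
  \<open>ball 0 (a i) \<subseteq> f i ` D i \<subseteq> ball 0 (b i)\<close>. Dividing \<open>f i\<close> by \<open>a i\<close> normalises all inner radii
  to \<open>1\<close>, and this is what makes the coordinatewise product map efficient: its image contains the
  unit polydisc, hence the Euclidean unit ball, while by Pythagoras it lies in the ball of radius
  \<open>sqrt (\<Sum>i. (b i / a i)\<^sup>2)\<close>. The ratio of these two radii is a lower bound for the squeezing
  function of the product (\<open>squeezing_function_product_ge_ratios\<close>). The planar squeezing functions
  are suprema of the quotients \<open>a i / b i\<close>, so the theorem follows by letting these quotients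
  converge to their suprema; the bound is continuous there because the suprema are positive.\<close>

definition planar_squeezing_ratios :: "complex set \<Rightarrow> complex \<Rightarrow> real set" where
  "planar_squeezing_ratios D z =
     {a / b | a b. 0 < a \<and> 0 < b \<and>
        (\<exists>f. f holomorphic_on D \<and> inj_on f D \<and> f z = 0 \<and>
             ball 0 a \<subseteq> f ` D \<and> f ` D \<subseteq> ball 0 b)}"

lemma planar_squeezing_function_eq_Sup:
  "planar_squeezing_function D z = Sup (planar_squeezing_ratios D z)"
  by (simp add: planar_squeezing_function_eq planar_squeezing_ratios_def)

lemma planar_squeezing_ratios_pos: "r \<in> planar_squeezing_ratios D z \<Longrightarrow> 0 < r"
  by (auto simp: planar_squeezing_ratios_def)

lemma planar_squeezing_ratios_bdd_above: "bdd_above (planar_squeezing_ratios D z)"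
proof (rule bdd_aboveI[of _ 1])
  fix r assume "r \<in> planar_squeezing_ratios D z"
  then obtain a b where r: "r = a / b" and ab: "0 < a" "0 < b"
    and "ball (0::complex) a \<subseteq> ball 0 b"
    unfolding planar_squeezing_ratios_def by blast
  then have "a \<le> b" by (simp add: ball_subset_ball_iff)
  then show "r \<le> 1" using r ab by simp
qed

lemma planar_squeezing_ratios_nonempty:
  assumes "bounded_domain D" "z \<in> D"
  shows "planar_squeezing_ratios D z \<noteq> {}"
proof -
  let ?f = "\<lambda>w. w - z"
  obtain a where a: "a > 0" "ball z a \<subseteq> D"
    using assms by (auto simp: bounded_domain_def open_contains_ball)
  have "bounded D" using assms by (simp add: bounded_domain_def)
  then obtain b where b: "b > 0" "D \<subseteq> ball z b"
    using bounded_subset_ballD[of D z] by blast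
  have "?f holomorphic_on D" "inj_on ?f D" "?f z = 0"
    by (auto intro!: holomorphic_intros simp: inj_on_def)
  moreover have "ball 0 a \<subseteq> ?f ` D"
  proof
    fix w :: complex assume "w \<in> ball 0 a"
    then have "w + z \<in> D" using a by (auto simp: dist_norm subset_iff)
    then show "w \<in> ?f ` D" by (rule rev_image_eqI) simp
  qed
  moreover have "?f ` D \<subseteq> ball 0 b"
    using b by (auto simp: dist_norm norm_minus_commute)
  ultimately show ?thesis
    using a b unfolding planar_squeezing_ratios_def by blast
qed

text \<open>On the product set the derivative is the diagonal complex-linear map given by the
  derivatives of the factors.\<close>

lemma holomorphic_map_on_coordinatewise:
  fixes g :: "'n::finite \<Rightarrow> complex \<Rightarrow> complex"
  assumes "\<And>i. g i holomorphic_on D i"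
  shows "holomorphic_map_on (\<lambda>w::complex^'n. \<chi> i. g i (w $ i)) {w. \<forall>i. w $ i \<in> D i}"
    (is "holomorphic_map_on _ ?P")
  unfolding holomorphic_map_on_def
proof
  fix w assume w: "w \<in> ?P"
  then have "\<forall>i. \<exists>d. (g i has_derivative (*) d) (at (w $ i) within D i)"
    using assms by (auto simp: holomorphic_on_def field_differentiable_def has_field_derivative_def)
  then obtain d where d: "\<And>i. (g i has_derivative (*) (d i)) (at (w $ i) within D i)"
    by metis
  have "((\<lambda>v::complex^'n. g i (v $ i)) has_derivative (\<lambda>v. d i * v $ i)) (at w within ?P)" for i
  proof -
    have "(g i has_derivative (*) (d i)) (at (w $ i) within (\<lambda>v. v $ i) ` ?P)"
      by (rule has_derivative_subset[OF d]) auto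
    then show ?thesis
      using has_derivative_in_compose[OF bounded_linear.has_derivative[OF bounded_linear_vec_nth
            has_derivative_ident]] by blast
  qed
  then have "((\<lambda>v::complex^'n. \<chi> i. g i (v $ i)) has_derivative (\<lambda>v. \<chi> i. d i * v $ i))
      (at w within ?P)"
    by (auto simp: has_derivative_componentwise_within[where 'b = "complex^'n"]
        Basis_vec_def inner_axis intro!: has_derivative_inner_left)
  then show "\<exists>F'. ((\<lambda>v. \<chi> i. g i (v $ i)) has_derivative F') (at w within ?P) \<and>
      (\<forall>c v. F' (c *s v) = c *s F' v)"
    by (intro exI[of _ "\<lambda>v. \<chi> i. d i * v $ i"]) (auto simp: vec_eq_iff)
qed

lemma coordinatewise_in_pointed_embeddings:
  fixes g :: "'n::finite \<Rightarrow> complex \<Rightarrow> complex" and z :: "complex^'n"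
  assumes "\<And>i. g i holomorphic_on D i" "\<And>i. inj_on (g i) (D i)" "\<And>i. g i (z $ i) = 0"
  shows "(\<lambda>w. \<chi> i. g i (w $ i)) \<in> pointed_embeddings {w. \<forall>i. w $ i \<in> D i} z"
proof -
  have "inj_on (\<lambda>w::complex^'n. \<chi> i. g i (w $ i)) {w. \<forall>i. w $ i \<in> D i}"
  proof (rule inj_onI)
    fix x y :: "complex^'n"
    assume "x \<in> {w. \<forall>i. w $ i \<in> D i}" "y \<in> {w. \<forall>i. w $ i \<in> D i}"
      and "(\<chi> i. g i (x $ i)) = (\<chi> i. g i (y $ i))"
    then have "x $ i = y $ i" for i
      using inj_onD[OF assms(2)[of i], of "x $ i" "y $ i"] by (simp add: vec_eq_iff)
    then show "x = y" by (simp add: vec_eq_iff)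
  qed
  then show ?thesis
    using assms(3) holomorphic_map_on_coordinatewise[of g D, OF assms(1)]
    by (simp add: pointed_embeddings_def vec_eq_iff)
qed

text \<open>The unit ball lies in the unit polydisc, which the coordinatewise map covers.\<close>

lemma unit_ball_subset_coordinatewise_image:
  fixes g :: "'n::finite \<Rightarrow> complex \<Rightarrow> complex"
  assumes "\<And>i. ball 0 1 \<subseteq> g i ` D i"
  shows "ball 0 1 \<subseteq> (\<lambda>w::complex^'n. \<chi> i. g i (w $ i)) ` {w. \<forall>i. w $ i \<in> D i}"
proof
  fix v :: "complex^'n" assume "v \<in> ball 0 1"
  then have "v $ i \<in> ball 0 1" for i
    using Finite_Cartesian_Product.norm_nth_le[of v i] by simp
  then have "\<forall>i. \<exists>x. x \<in> D i \<and> v $ i = g i x"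
    using assms by (meson imageE subsetD)
  then obtain x where "\<And>i. x i \<in> D i" "\<And>i. v $ i = g i (x i)"
    by metis
  then show "v \<in> (\<lambda>w::complex^'n. \<chi> i. g i (w $ i)) ` {w. \<forall>i. w $ i \<in> D i}"
    by (intro image_eqI[of _ _ "\<chi> i. x i"]) (auto simp: vec_eq_iff)
qed

lemma coordinatewise_image_subset_ball:
  fixes g :: "'n::finite \<Rightarrow> complex \<Rightarrow> complex"
  assumes "\<And>i. g i ` D i \<subseteq> ball 0 (c i)"
  shows "(\<lambda>w::complex^'n. \<chi> i. g i (w $ i)) ` {w. \<forall>i. w $ i \<in> D i}
           \<subseteq> ball 0 (sqrt (\<Sum>i\<in>UNIV. (c i)\<^sup>2))"
proof clarify
  fix w :: "complex^'n" assume "\<forall>i. w $ i \<in> D i"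
  then have "norm (g i (w $ i)) < c i" for i
    using assms[of i] by (auto simp: image_subset_iff)
  then have "L2_set (\<lambda>i. norm (g i (w $ i))) UNIV < L2_set c UNIV"
    by (intro L2_set_strict_mono) auto
  then show "(\<chi> i. g i (w $ i)) \<in> ball 0 (sqrt (\<Sum>i\<in>UNIV. (c i)\<^sup>2))"
    by (simp add: norm_vec_def L2_set_def)
qed

text \<open>Scaling each factor separately is what turns the bound into a function of the quotients
  \<open>a i / b i\<close> alone: once every inner radius is \<open>1\<close>, the outer radii are \<open>1 / r i\<close>.\<close>

lemma squeezing_function_product_ge_ratios:
  fixes r :: "'n::finite \<Rightarrow> real" and z :: "complex^'n"
  assumes r: "\<And>i. r i \<in> planar_squeezing_ratios (D i) (z $ i)"
  shows "(\<Sum>i\<in>UNIV. r i powr (-2)) powr (-1/2) \<le> squeezing_function {w. \<forall>i. w $ i \<in> D i} z"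
proof -
  have "\<exists>g. g holomorphic_on D i \<and> inj_on g (D i) \<and> g (z $ i) = 0 \<and>
          ball 0 1 \<subseteq> g ` D i \<and> g ` D i \<subseteq> ball 0 (1 / r i)" for i
  proof -
    obtain a b f where ab: "0 < a" "0 < b" "r i = a / b"
      and f: "f holomorphic_on D i" "inj_on f (D i)" "f (z $ i) = 0"
      and B: "ball 0 a \<subseteq> f ` D i" "f ` D i \<subseteq> ball 0 b"
      using r[of i] unfolding planar_squeezing_ratios_def by blast
    let ?g = "\<lambda>x. f x / of_real a"
    have "?g holomorphic_on D i" "inj_on ?g (D i)" "?g (z $ i) = 0"
      using f ab by (auto intro!: holomorphic_intros simp: inj_on_def)
    moreover have "ball 0 1 \<subseteq> ?g ` D i"
    proof
      fix y :: complex assume "y \<in> ball 0 1"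
      then have "of_real a * y \<in> ball 0 a" using ab by (simp add: norm_mult)
      then obtain x where "x \<in> D i" "f x = of_real a * y" using B by (metis imageE subsetD)
      then show "y \<in> ?g ` D i" using ab by (intro image_eqI[of _ _ x]) auto
    qed
    moreover have "?g ` D i \<subseteq> ball 0 (1 / r i)"
      using B ab by (auto simp: image_subset_iff norm_divide divide_strict_right_mono)
    ultimately show ?thesis by blast
  qed
  then obtain g where g: "\<And>i. g i holomorphic_on D i" "\<And>i. inj_on (g i) (D i)"
      "\<And>i. g i (z $ i) = 0" "\<And>i. ball 0 1 \<subseteq> g i ` D i" "\<And>i. g i ` D i \<subseteq> ball 0 (1 / r i)"
    by metis
  let ?s = "\<Sum>i\<in>UNIV. (1 / r i)\<^sup>2"
  have pos: "r i > 0" for i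
    using planar_squeezing_ratios_pos[OF r] .
  then have "(1 / r i)\<^sup>2 > 0" for i
    by (simp add: less_imp_neq[THEN not_sym])
  then have "?s > 0"
    by (intro sum_pos) auto
  then have "1 / sqrt ?s \<le> squeezing_function {w. \<forall>i. w $ i \<in> D i} z"
    unfolding squeezing_function_def
    using coordinatewise_in_pointed_embeddings[of g D z, OF g(1-3)]
      unit_ball_subset_coordinatewise_image[of g D, OF g(4)]
      coordinatewise_image_subset_ball[of g D "\<lambda>i. 1 / r i", OF g(5)]
    by (intro cSup_upper squeezing_set_bdd_above CollectI exI[of _ 1] exI[of _ "sqrt ?s"] conjI
        bexI[of _ "\<lambda>w. \<chi> i. g i (w $ i)"]) auto
  moreover have "(\<Sum>i\<in>UNIV. r i powr (-2)) = ?s"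
    using pos by (intro sum.cong) (auto simp: powr_minus powr_numeral field_simps less_imp_le)
  moreover have "?s powr (-1/2) = 1 / sqrt ?s"
    using \<open>?s > 0\<close> by (simp add: powr_minus powr_half_sqrt inverse_eq_divide minus_divide_left[symmetric])
  ultimately show ?thesis by simp
qed

theorem theorem1p3:
  fixes D :: "'n::finite \<Rightarrow> complex set"
    and \<Omega> :: "(complex^'n) set"
    and z :: "complex^'n"
  assumes "\<And>i. bounded_domain (D i)"
    and "\<Omega> = {w. \<forall>i. w $ i \<in> D i}"
    and "z \<in> \<Omega>"
  shows "squeezing_function \<Omega> z
           \<ge> (\<Sum>i\<in>UNIV. planar_squeezing_function (D i) (z $ i) powr (-2)) powr (-1/2)"
proof -
  let ?R = "\<lambda>i. planar_squeezing_ratios (D i) (z $ i)"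
  let ?S = "\<lambda>i. planar_squeezing_function (D i) (z $ i)"
  have ne: "?R i \<noteq> {}" for i
    using planar_squeezing_ratios_nonempty assms by simp
  have "?S i \<in> closure (?R i)" for i
    using closure_contains_Sup[OF ne planar_squeezing_ratios_bdd_above]
    by (simp add: planar_squeezing_function_eq_Sup)
  then obtain r where r: "\<And>i k. r i k \<in> ?R i" "\<And>i. r i \<longlonglongrightarrow> ?S i"
    unfolding closure_sequential by metis
  \<comment> \<open>Positivity of the suprema is essential: \<open>powr (-2)\<close> is discontinuous at \<open>0\<close>.\<close>
  have pos: "?S i > 0" for i
    using cSup_upper[OF r(1)[of i 0] planar_squeezing_ratios_bdd_above]
      planar_squeezing_ratios_pos[OF r(1)[of i 0]]
    by (simp add: planar_squeezing_function_eq_Sup)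
  then have "?S i powr (-2) > 0" for i
    by (simp add: less_imp_neq[THEN not_sym])
  then have "(\<Sum>i\<in>UNIV. ?S i powr (-2)) > 0"
    by (intro sum_pos) auto
  then have "(\<lambda>k. (\<Sum>i\<in>UNIV. r i k powr (-2)) powr (-1/2))
      \<longlonglongrightarrow> (\<Sum>i\<in>UNIV. ?S i powr (-2)) powr (-1/2)"
    using r(2) pos
    by (intro tendsto_powr tendsto_sum tendsto_const) (auto simp: less_imp_neq[THEN not_sym])
  moreover have "(\<Sum>i\<in>UNIV. r i k powr (-2)) powr (-1/2) \<le> squeezing_function \<Omega> z" for k
    unfolding assms(2) by (rule squeezing_function_product_ge_ratios) (rule r(1))
  ultimately show ?thesis
    by (intro LIMSEQ_le_const2) auto
qed

end
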